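(* Let $T:C(\overline\Omega)\to C(\overline\Omega)$ be the nonlinear operator $$T(u)(x)=u_0(x)-k^2\int_\Omega G(x,y)\left(\alpha(y)u(y)+\beta(y)u^3(y)\right)dy,$$ and let $\mu=k^2\sup_{x\in\Omega}\int_\Omega|G(x,y)|\,dy$. If there exists $\gamma>1/2$ such that $$\|\alpha\|_\infty<\frac{2\gamma-1}{2\mu(1+\gamma)}\qquad\text{and}\qquad \|\beta\|_\infty<\frac{1}{2\mu\|u_0\|_\infty^2(1+\gamma)^3},$$ then $T$ has a unique fixed point on the (closed) ball of radius $\gamma\|u_0\|_\infty$ about $u_0$ in $C(\overline\Omega)$.
   Context: $\Omega\subset\mathbb{R}^d$, $d>2$, is a bounded domain with smooth boundary $\partial\Omega$, $\nu$ is the unit outward normal, and $k>0$ is the wavenumber. The coefficients $\alpha,\beta\in L^\infty(\Omega)$ are real valued. The background field $u_0\in C(\overline\Omega)$, $u_0\neq0$, is real valued and solves $\Delta u_0+k^2u_0=0$ in $\Omega$, $\partial u_0/\partial\nu=g$ on $\partial\Omega$, for a real-valued boundary source $g$. $G$ is the Green's function: $\Delta_xG(x,y)+k^2G(x,y)=\delta(x-y)$ in $\Omega$ with $\partial G/\partial\nu_y=0$ on $\partial\Omega$ (it is assumed that $k$ is such that $G$ exists). $C(\overline\Omega)$ carries the sup norm $\|\cdot\|_\infty$. *)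

theory Defs
  imports "HOL-Analysis.Analysis" "HOL-Probability.Essential_Supremum"
begin

section \<open>Classical derivatives\<close>

text \<open>
  Directional derivative at \<open>x\<close> along \<open>b\<close>; it is meaningful only where
  \<open>has_partial b f x\<close> holds.
\<close>

definition has_partial :: "'a::euclidean_space \<Rightarrow> ('a \<Rightarrow> real) \<Rightarrow> 'a \<Rightarrow> bool" where
  "has_partial b f x \<longleftrightarrow> (\<lambda>t::real. f (x + t *\<^sub>R b)) field_differentiable (at 0)"

definition partial :: "'a::euclidean_space \<Rightarrow> ('a \<Rightarrow> real) \<Rightarrow> 'a \<Rightarrow> real" where
  "partial b f x = deriv (\<lambda>t::real. f (x + t *\<^sub>R b)) 0"

text \<open>The class \<open>C\<^sup>m(S)\<close> for open \<open>S\<close>: all partial derivatives up to order \<open>m\<close> exist and are continuous.\<close>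

primrec C_on :: "nat \<Rightarrow> 'a::euclidean_space set \<Rightarrow> ('a \<Rightarrow> real) \<Rightarrow> bool" where
  "C_on 0 S f \<longleftrightarrow> continuous_on S f"
| "C_on (Suc m) S f \<longleftrightarrow>
     continuous_on S f \<and> (\<forall>b\<in>Basis. (\<forall>x\<in>S. has_partial b f x) \<and> C_on m S (partial b f))"

definition smooth_on :: "'a::euclidean_space set \<Rightarrow> ('a \<Rightarrow> real) \<Rightarrow> bool" where
  "smooth_on S f \<longleftrightarrow> (\<forall>m. C_on m S f)"

definition laplacian :: "('a::euclidean_space \<Rightarrow> real) \<Rightarrow> 'a \<Rightarrow> real" where
  "laplacian f x = (\<Sum>b\<in>Basis. partial b (partial b f) x)"

section \<open>Smooth domains and normal derivatives\<close>

text \<open>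
  Near the boundary point \<open>p\<close> the set \<open>\<Omega>\<close> is the sublevel set \<open>\<rho> < 0\<close> of a smooth
  function with nowhere vanishing gradient (so \<open>\<rho> = 0\<close> is the boundary and
  the gradient of \<open>\<rho>\<close> points out of \<open>\<Omega>\<close>).
\<close>

definition local_defining_function ::
    "'a::euclidean_space set \<Rightarrow> 'a \<Rightarrow> 'a set \<Rightarrow> ('a \<Rightarrow> real) \<Rightarrow> bool" where
  "local_defining_function \<Omega> p U \<rho> \<longleftrightarrow>
     open U \<and> p \<in> U \<and> smooth_on U \<rho> \<and> (\<forall>x\<in>U. \<exists>b\<in>Basis. partial b \<rho> x \<noteq> 0) \<and>
     \<Omega> \<inter> U = {x\<in>U. \<rho> x < 0}"

definition smooth_bounded_domain :: "'a::euclidean_space set \<Rightarrow> bool" where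
  "smooth_bounded_domain \<Omega> \<longleftrightarrow>
     \<Omega> \<noteq> {} \<and> open \<Omega> \<and> connected \<Omega> \<and> bounded \<Omega> \<and>
     (\<forall>p\<in>frontier \<Omega>. \<exists>U \<rho>. local_defining_function \<Omega> p U \<rho>)"

definition unit_outward_normal :: "'a::euclidean_space set \<Rightarrow> 'a \<Rightarrow> 'a \<Rightarrow> bool" where
  "unit_outward_normal \<Omega> p n \<longleftrightarrow>
     norm n = 1 \<and>
     (\<exists>U \<rho> c. local_defining_function \<Omega> p U \<rho> \<and> c > 0 \<and> (\<forall>b\<in>Basis. partial b \<rho> p = c * (n \<bullet> b)))"

text \<open>
  Derivative at the boundary point \<open>p\<close> in the outward direction \<open>n\<close>. It is one-sided, since
  functions are only given on the closure of the domain and \<open>p + t n\<close> lies inside it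
  for small \<open>t < 0\<close>.
\<close>

definition has_normal_derivative ::
    "('a::euclidean_space \<Rightarrow> real) \<Rightarrow> 'a \<Rightarrow> 'a \<Rightarrow> real \<Rightarrow> bool" where
  "has_normal_derivative f n p c \<longleftrightarrow>
     ((\<lambda>t::real. f (p + t *\<^sub>R n)) has_real_derivative c) (at_left 0)"

section \<open>The background problem and the Green's function\<close>

definition neumann_helmholtz_solution ::
    "'a::euclidean_space set \<Rightarrow> ('a \<Rightarrow> 'a) \<Rightarrow> real \<Rightarrow> ('a \<Rightarrow> real) \<Rightarrow> ('a \<Rightarrow> real) \<Rightarrow> bool" where
  "neumann_helmholtz_solution \<Omega> \<nu> k g u \<longleftrightarrow>
     C_on 2 \<Omega> u \<and> (\<forall>x\<in>\<Omega>. laplacian u x + k\<^sup>2 * u x = 0) \<and>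
     (\<forall>y\<in>frontier \<Omega>. has_normal_derivative u (\<nu> y) y (g y))"

definition test_function :: "'a::euclidean_space set \<Rightarrow> ('a \<Rightarrow> real) \<Rightarrow> bool" where
  "test_function \<Omega> \<phi> \<longleftrightarrow>
     smooth_on UNIV \<phi> \<and> (\<exists>K. compact K \<and> K \<subseteq> \<Omega> \<and> (\<forall>x. x \<notin> K \<longrightarrow> \<phi> x = 0))"

text \<open>
  The equation \<open>\<Delta>\<^sub>x G(x,y) + k\<^sup>2 G(x,y) = \<delta>(x - y)\<close> is understood in the sense of
  distributions in \<open>x\<close>, for every \<open>y \<in> \<Omega>\<close>; the boundary condition concerns the second
  variable. Measurability in the second variable is what makes integrals of
  \<open>G(x,y)\<close> over \<open>y\<close> meaningful.
\<close>

definition neumann_green_function ::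
    "'a::euclidean_space set \<Rightarrow> ('a \<Rightarrow> 'a) \<Rightarrow> real \<Rightarrow> ('a \<Rightarrow> 'a \<Rightarrow> real) \<Rightarrow> bool" where
  "neumann_green_function \<Omega> \<nu> k G \<longleftrightarrow>
     (\<forall>y\<in>\<Omega>.
        (\<forall>K. compact K \<longrightarrow> K \<subseteq> \<Omega> \<longrightarrow> set_integrable lebesgue K (\<lambda>x. G x y)) \<and>
        (\<forall>\<phi>. test_function \<Omega> \<phi> \<longrightarrow>
           (LINT x:\<Omega>|lebesgue. G x y * (laplacian \<phi> x + k\<^sup>2 * \<phi> x)) = \<phi> y)) \<and>
     (\<forall>x\<in>\<Omega>. \<forall>y\<in>frontier \<Omega>. has_normal_derivative (G x) (\<nu> y) y 0) \<and>
     (\<forall>x\<in>\<Omega>. G x \<in> borel_measurable (lebesgue_on \<Omega>))"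

section \<open>Function spaces and the integral operator\<close>

text \<open>
  Continuous functions on the closure of a bounded \<open>\<Omega>\<close>, with the sup norm metric. Elements
  are extensional (\<open>undefined\<close> off the closure), so HOL equality of elements is
  equality on the closure.
\<close>

definition C_closure :: "'a::euclidean_space set \<Rightarrow> ('a \<Rightarrow> real) metric" where
  "C_closure \<Omega> = cfunspace (top_of_set (closure \<Omega>)) euclidean_metric"

definition sup_norm :: "'a::euclidean_space set \<Rightarrow> ('a \<Rightarrow> real) \<Rightarrow> real" where
  "sup_norm \<Omega> u = (SUP x\<in>closure \<Omega>. \<bar>u x\<bar>)"

definition Linf_norm :: "'a::euclidean_space set \<Rightarrow> ('a \<Rightarrow> real) \<Rightarrow> ennreal" where
  "Linf_norm \<Omega> f = esssup (lebesgue_on \<Omega>) (\<lambda>x. ennreal \<bar>f x\<bar>)"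

definition Linf :: "'a::euclidean_space set \<Rightarrow> ('a \<Rightarrow> real) set" where
  "Linf \<Omega> = {f \<in> borel_measurable (lebesgue_on \<Omega>). Linf_norm \<Omega> f < \<infinity>}"

definition T_op :: "'a::euclidean_space set \<Rightarrow> real \<Rightarrow> ('a \<Rightarrow> 'a \<Rightarrow> real) \<Rightarrow> ('a \<Rightarrow> real) \<Rightarrow>
    ('a \<Rightarrow> real) \<Rightarrow> ('a \<Rightarrow> real) \<Rightarrow> ('a \<Rightarrow> real) \<Rightarrow> 'a \<Rightarrow> real" where
  "T_op \<Omega> k G \<alpha> \<beta> u\<^sub>0 u =
     (\<lambda>x\<in>closure \<Omega>. u\<^sub>0 x - k\<^sup>2 * (LINT y:\<Omega>|lebesgue. G x y * (\<alpha> y * u y + \<beta> y * u y ^ 3)))"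

text \<open>
  The constant \<open>\<mu>\<close> takes values in \<open>[0,\<infinity>]\<close>; if it is infinite, upper bounds of the form
  \<open>c / \<mu>\<close> are \<open>0\<close>, and strict inequalities against them cannot hold.
\<close>

definition green_const :: "'a::euclidean_space set \<Rightarrow> real \<Rightarrow> ('a \<Rightarrow> 'a \<Rightarrow> real) \<Rightarrow> ennreal" where
  "green_const \<Omega> k G =
     ennreal (k\<^sup>2) * (SUP x\<in>\<Omega>. \<integral>\<^sup>+ y. ennreal \<bar>G x y\<bar> \<partial>lebesgue_on \<Omega>)"

end

theory Submission
  imports Defs
begin

text \<open>
  On the ball every \<open>u\<close> satisfies \<open>\<bar>u\<bar> \<le> R = (1 + \<gamma>) \<parallel>u\<^sub>0\<parallel>\<close>. Hence
  \<open>\<parallel>T u - u\<^sub>0\<parallel> \<le> \<mu> (\<parallel>\<alpha>\<parallel> R + \<parallel>\<beta>\<parallel> R\<^sup>3) \<le> \<gamma> \<parallel>u\<^sub>0\<parallel>\<close>, and since \<open>\<bar>u\<^sup>3 - v\<^sup>3\<bar> \<le> 3 R\<^sup>2 \<bar>u - v\<bar>\<close>,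
  \<open>T\<close> has Lipschitz constant \<open>\<mu> (\<parallel>\<alpha>\<parallel> + 3 \<parallel>\<beta>\<parallel> R\<^sup>2)\<close>, which the hypotheses make less than
  \<open>(2\<gamma> - 1) / (2 (1 + \<gamma>)) + 3 / (2 (1 + \<gamma>)) = 1\<close>. So Banach's fixed point theorem applies to the ball.
  The Green's function is controlled only for \<open>x \<in> \<Omega>\<close>; the estimates
  pass to the closure because \<open>T u\<close> is continuous there.
\<close>

text \<open>Clears the denominators in the hypotheses on \<alpha> and \<beta>. In the degenerate
  cases, z = 0 makes the product 0, and z = \<open>top\<close> makes the quotient 0, so that the
  second assumption fails.\<close>

lemma ennreal_less_divide_imp_mult_less:
  fixes x p z :: ennreal
  assumes "0 < p" and "x < p / z"
  shows "z * x < p"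
proof (cases "z = 0 \<or> z = top")
  case True
  then show ?thesis
    using assms by (auto simp: divide_ennreal_def)
next
  case False
  then show ?thesis
    using assms
    by (cases x; cases p; cases z)
       (auto simp: divide_ennreal ennreal_mult[symmetric] ennreal_less_iff field_simps
         ennreal_mult_less_top ennreal_top_divide)
qed

text \<open>Factor the difference of cubes as (a a + a b + b b) (a - b); each of the three products
  is at most R R in absolute value.\<close>

lemma abs_cube_diff_le:
  fixes a b :: real
  assumes "\<bar>a\<bar> \<le> R" and "\<bar>b\<bar> \<le> R"
  shows "\<bar>a ^ 3 - b ^ 3\<bar> \<le> 3 * R\<^sup>2 * \<bar>a - b\<bar>"
proof -
  have "R \<ge> 0"
    using assms by linarith
  have sq: "\<bar>a * a\<bar> \<le> R * R" "\<bar>a * b\<bar> \<le> R * R" "\<bar>b * b\<bar> \<le> R * R"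
    unfolding abs_mult using assms \<open>R \<ge> 0\<close> by (intro mult_mono; simp)+
  have "\<bar>a ^ 3 - b ^ 3\<bar> = \<bar>a * a + a * b + b * b\<bar> * \<bar>a - b\<bar>"
    unfolding abs_mult[symmetric] by (rule arg_cong[where f = abs]) (simp add: power3_eq_cube algebra_simps)
  also have "\<dots> \<le> 3 * R\<^sup>2 * \<bar>a - b\<bar>"
    unfolding power2_eq_square using sq by (intro mult_right_mono) linarith+
  finally show ?thesis .
qed

text \<open>A closed ball is a closed subset of a complete space, hence complete as a subspace, and
  it contains its centre because 0 \<le> r. Banach's theorem therefore applies to the restriction of
  \<open>T\<close>, which has to be a contraction on the ball only.\<close>

lemma closed_ball_unique_fixed_point:
  fixes m :: "'a metric"
  assumes "mcomplete_of m" and "c \<in> mspace m" and "0 \<le> r" and "q < 1"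
    and maps: "\<And>u. \<lbrakk>u \<in> mspace m; mdist m c u \<le> r\<rbrakk> \<Longrightarrow> T u \<in> mspace m \<and> mdist m c (T u) \<le> r"
    and contr: "\<And>u v. \<lbrakk>u \<in> mspace m; mdist m c u \<le> r; v \<in> mspace m; mdist m c v \<le> r\<rbrakk>
                  \<Longrightarrow> mdist m (T u) (T v) \<le> q * mdist m u v"
  shows "\<exists>!u. u \<in> mspace m \<and> mdist m c u \<le> r \<and> T u = u"
proof -
  interpret M: Metric_space "mspace m" "mdist m"
    by (rule Metric_space_mspace_mdist)
  interpret B: Submetric "mspace m" "mdist m" "M.mcball c r"
    by unfold_locales auto
  have B_complete: "B.sub.mcomplete"
    using assms(1) by (intro B.closedin_mcomplete_imp_mcomplete) (auto simp: mcomplete_of_def)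
  have T_B: "T \<in> M.mcball c r \<rightarrow> M.mcball c r"
    using maps \<open>c \<in> mspace m\<close> by auto
  have contr_B: "mdist m (T u) (T v) \<le> q * mdist m u v"
    if "u \<in> M.mcball c r" "v \<in> M.mcball c r" for u v
    using contr that by auto
  have "c \<in> M.mcball c r"
    using assms(2,3) by simp
  then have "M.mcball c r \<noteq> {}"
    by blast
  then obtain u where "u \<in> M.mcball c r" "T u = u"
    using B.sub.Banach_fixedpoint_thm[OF B_complete _ T_B \<open>q < 1\<close> contr_B] by blast
  then show ?thesis
    using B.sub.contraction_imp_unique_fixpoint[OF _ _ T_B \<open>q < 1\<close> contr_B] \<open>c \<in> mspace m\<close>
    by (intro ex1I[of _ u]) auto
qed

text \<open>Bounded continuous functions into a complete space are complete in the sup metric, and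
  the reals are complete.\<close>

lemma mcomplete_C_closure: "mcomplete_of (C_closure \<Omega>)"
  using Met_TC.mcomplete_cfunspace[OF complete_UNIV[unfolded mcomplete_iff_complete[symmetric]]]
  by (simp add: C_closure_def euclidean_metric_def Met_TC.Self_def)

lemma continuous_on_C_closure:
  assumes "u \<in> mspace (C_closure \<Omega>)"
  shows "continuous_on (closure \<Omega>) u"
  using assms by (simp add: C_closure_def)

lemma abs_diff_le_mdist_C_closure:
  assumes "u \<in> mspace (C_closure \<Omega>)" and "v \<in> mspace (C_closure \<Omega>)" and "x \<in> closure \<Omega>"
  shows "\<bar>u x - v x\<bar> \<le> mdist (C_closure \<Omega>) u v"
  using mdist_cfunspace_imp_mdist_le[of u "top_of_set (closure \<Omega>)" euclidean_metric v _ x] assms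
  by (simp add: C_closure_def dist_real_def)

text \<open>A real-valued \<open>SUP\<close> is an upper bound only for a family bounded above;
  members of \<open>cfunspace\<close> have bounded range.\<close>

lemma abs_le_sup_norm:
  assumes "u \<in> mspace (C_closure \<Omega>)" and "x \<in> closure \<Omega>"
  shows "\<bar>u x\<bar> \<le> sup_norm \<Omega> u"
proof -
  have "bounded (u ` closure \<Omega>)"
    using assms(1) by (simp add: C_closure_def)
  then have "bdd_above ((\<lambda>x. \<bar>u x\<bar>) ` closure \<Omega>)"
    by (force simp: bounded_iff bdd_above_def)
  then show ?thesis
    unfolding sup_norm_def using assms(2) by (rule cSUP_upper2) simp
qed

text \<open>\<Omega> is dense in its closure and the absolute difference is continuous there, so an
  estimate at interior points already controls the sup metric.\<close>

lemma mdist_C_closure_le: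
  assumes "u \<in> mspace (C_closure \<Omega>)" and "v \<in> mspace (C_closure \<Omega>)" and "0 \<le> c"
    and bound: "\<And>x. x \<in> \<Omega> \<Longrightarrow> \<bar>u x - v x\<bar> \<le> c"
  shows "mdist (C_closure \<Omega>) u v \<le> c"
proof -
  have "\<bar>u x - v x\<bar> \<le> c" if "x \<in> closure \<Omega>" for x
  proof (rule continuous_le_on_closure[OF _ that bound])
    show "continuous_on (closure \<Omega>) (\<lambda>x. \<bar>u x - v x\<bar>)"
      using assms(1,2) by (intro continuous_intros continuous_on_C_closure)
  qed
  then show ?thesis
    unfolding C_closure_def using \<open>0 \<le> c\<close>
    by (intro mdist_cfunspace_le) (auto simp: dist_real_def)
qed

lemma AE_abs_le_Linf_norm:
  assumes "Linf_norm \<Omega> f = ennreal a" and "0 \<le> a"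
  shows "AE y in lebesgue_on \<Omega>. \<bar>f y\<bar> \<le> a"
  using esssup_AE[where M = "lebesgue_on \<Omega>" and f = "\<lambda>x. ennreal \<bar>f x\<bar>"] assms
  by (simp add: Linf_norm_def)

text \<open>Hoelder's inequality for an integrable kernel and an essentially bounded function. The
  factor s will be k squared, so that m can be the value of \<mu>.\<close>

lemma kernel_integral_bound:
  fixes K f :: "'a \<Rightarrow> real"
  assumes [measurable]: "K \<in> borel_measurable M" "f \<in> borel_measurable M"
    and f: "AE y in M. \<bar>f y\<bar> \<le> c" and "0 \<le> c" and "0 \<le> m" and "s > 0"
    and K: "ennreal s * (\<integral>\<^sup>+ y. ennreal \<bar>K y\<bar> \<partial>M) \<le> ennreal m"
  shows "integrable M (\<lambda>y. K y * f y)"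
    and "\<bar>s * (\<integral>y. K y * f y \<partial>M)\<bar> \<le> m * c"
proof -
  \<comment> \<open>Since s > 0, an infinite integral would make the left side of \<open>K\<close>
    infinite, while m is real.\<close>
  have "(\<integral>\<^sup>+ y. ennreal \<bar>K y\<bar> \<partial>M) < top"
    using K \<open>s > 0\<close> ennreal_mult_top[of s]
    by (cases "(\<integral>\<^sup>+ y. ennreal \<bar>K y\<bar> \<partial>M) = top") (auto simp: top_unique less_top ennreal_mult_eq_top_iff)
  then have int_K: "integrable M K"
    by (intro integrableI_bounded) auto
  have Kf: "AE y in M. norm (K y * f y) \<le> norm (c * K y)"
    using f by eventually_elim (simp add: abs_mult mult.commute[of c] \<open>0 \<le> c\<close> mult_left_mono)
  show int_Kf: "integrable M (\<lambda>y. K y * f y)"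
    by (rule Bochner_Integration.integrable_bound[OF integrable_mult_right[OF int_K] _ Kf]) measurable
  have "ennreal (s * (\<integral>y. \<bar>K y\<bar> \<partial>M)) \<le> ennreal m"
    using K int_K \<open>s > 0\<close> by (simp add: nn_integral_eq_integral ennreal_mult)
  then have sK: "s * (\<integral>y. \<bar>K y\<bar> \<partial>M) \<le> m"
    using \<open>0 \<le> m\<close> by (simp add: ennreal_le_iff)
  have "\<bar>\<integral>y. K y * f y \<partial>M\<bar> \<le> (\<integral>y. \<bar>K y * f y\<bar> \<partial>M)"
    by (rule integral_abs_bound)
  also have "\<dots> \<le> (\<integral>y. c * \<bar>K y\<bar> \<partial>M)"
    using int_Kf integrable_abs[OF int_Kf] int_K Kf \<open>0 \<le> c\<close>
    by (intro integral_mono_AE) (auto simp: abs_mult)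
  finally have "s * \<bar>\<integral>y. K y * f y \<partial>M\<bar> \<le> s * (c * (\<integral>y. \<bar>K y\<bar> \<partial>M))"
    using \<open>s > 0\<close> by simp
  also have "\<dots> \<le> m * c"
    using mult_right_mono[OF sK \<open>0 \<le> c\<close>] by (simp add: ac_simps)
  finally show "\<bar>s * (\<integral>y. K y * f y \<partial>M)\<bar> \<le> m * c"
    using \<open>s > 0\<close> by (simp add: abs_mult)
qed

theorem proposition1:
  fixes \<Omega> :: "(real ^ 'd) set" and \<nu> :: "real ^ 'd \<Rightarrow> real ^ 'd"
    and k \<gamma> :: real and g u\<^sub>0 \<alpha> \<beta> :: "real ^ 'd \<Rightarrow> real"
    and G :: "real ^ 'd \<Rightarrow> real ^ 'd \<Rightarrow> real"
    and T :: "(real ^ 'd \<Rightarrow> real) \<Rightarrow> (real ^ 'd \<Rightarrow> real)" and \<mu> :: ennreal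
  assumes "CARD('d) > 2"
    and "smooth_bounded_domain \<Omega>"
    and "\<And>y. y \<in> frontier \<Omega> \<Longrightarrow> unit_outward_normal \<Omega> y (\<nu> y)"
    and "k > 0"
    and "\<alpha> \<in> Linf \<Omega>" and "\<beta> \<in> Linf \<Omega>"
    and "u\<^sub>0 \<in> mspace (C_closure \<Omega>)"
    and "\<exists>x\<in>closure \<Omega>. u\<^sub>0 x \<noteq> 0"
    and "neumann_helmholtz_solution \<Omega> \<nu> k g u\<^sub>0"
    and "neumann_green_function \<Omega> \<nu> k G"
    and T_eq: "T = T_op \<Omega> k G \<alpha> \<beta> u\<^sub>0"
    and T_maps: "T \<in> mspace (C_closure \<Omega>) \<rightarrow> mspace (C_closure \<Omega>)"
    and mu_eq: "\<mu> = green_const \<Omega> k G"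
    and "\<gamma> > 1/2"
    and "Linf_norm \<Omega> \<alpha> < ennreal (2 * \<gamma> - 1) / (2 * \<mu> * ennreal (1 + \<gamma>))"
    and "Linf_norm \<Omega> \<beta> < 1 / (2 * \<mu> * ennreal ((sup_norm \<Omega> u\<^sub>0)\<^sup>2) * ennreal ((1 + \<gamma>) ^ 3))"
  shows "\<exists>!u. u \<in> mspace (C_closure \<Omega>) \<and>
              mdist (C_closure \<Omega>) u\<^sub>0 u \<le> \<gamma> * sup_norm \<Omega> u\<^sub>0 \<and> T u = u"
proof -

  \<comment> \<open>Notation, measurability and positivity\<close>
  let ?X = "C_closure \<Omega>" and ?N = "lebesgue_on \<Omega>"
  define M where "M = sup_norm \<Omega> u\<^sub>0"
  define R where "R = (1 + \<gamma>) * M"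
  have k: "k > 0" and \<gamma>: "\<gamma> > 1/2" and u0: "u\<^sub>0 \<in> mspace ?X"
    using assms by blast+
  have [measurable]: "\<alpha> \<in> borel_measurable ?N" "\<beta> \<in> borel_measurable ?N"
    using assms(5,6) by (auto simp: Linf_def)
  have "open \<Omega>"
    using assms(2) by (simp add: smooth_bounded_domain_def)
  then have \<Omega>_sets: "\<Omega> \<in> sets lebesgue"
    by simp
  have meas_u: "u \<in> borel_measurable ?N" if "u \<in> mspace ?X" for u
    using continuous_on_C_closure[OF that] closure_subset \<Omega>_sets
    by (intro continuous_imp_measurable_on_sets_lebesgue) (auto intro: continuous_on_subset)
  have meas_G [measurable]: "G x \<in> borel_measurable ?N" if "x \<in> \<Omega>" for x
    using assms(10) that by (simp add: neumann_green_function_def)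
  obtain x\<^sub>0 where "x\<^sub>0 \<in> closure \<Omega>" "u\<^sub>0 x\<^sub>0 \<noteq> 0"
    using assms(8) by blast
  then have "M > 0"
    using abs_le_sup_norm[OF u0] unfolding M_def by fastforce
  then have "R > 0"
    using \<gamma> by (simp add: R_def)

  \<comment> \<open>An infinite \<mu> would turn the bound on \<alpha> into a strict inequality
    below 0 in \<open>ennreal\<close>.\<close>
  have "\<mu> \<noteq> top"
    using assms(15) \<gamma> by (auto simp: ennreal_mult_top ennreal_top_mult)
  then obtain m where m: "\<mu> = ennreal m" "0 \<le> m"
    by (cases \<mu>) auto
  obtain a where a: "Linf_norm \<Omega> \<alpha> = ennreal a" "0 \<le> a"
    using assms(5) by (cases "Linf_norm \<Omega> \<alpha>") (auto simp: Linf_def)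
  obtain b where b: "Linf_norm \<Omega> \<beta> = ennreal b" "0 \<le> b"
    using assms(6) by (cases "Linf_norm \<Omega> \<beta>") (auto simp: Linf_def)

  \<comment> \<open>The smallness conditions as inequalities between reals\<close>
  have "ennreal (2 * m * (1 + \<gamma>) * a) < ennreal (2 * \<gamma> - 1)"
    using ennreal_less_divide_imp_mult_less[OF _ assms(15)] m a \<gamma>
    by (simp add: ennreal_mult)
  then have ma: "2 * m * (1 + \<gamma>) * a < 2 * \<gamma> - 1"
    using \<gamma> by (simp add: ennreal_less_iff m a)
  have "ennreal (2 * m * M\<^sup>2 * (1 + \<gamma>) ^ 3 * b) < ennreal 1"
    using ennreal_less_divide_imp_mult_less[OF _ assms(16)] m b \<gamma>
    by (simp add: ennreal_mult M_def)
  then have mb: "2 * m * M\<^sup>2 * (1 + \<gamma>) ^ 3 * b < 1"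
    using \<gamma> by (simp add: ennreal_less_iff m b)
  define q where "q = m * (a + 3 * b * R\<^sup>2)"
  \<comment> \<open>Multiplying by 2 (1 + \<gamma>) exposes the left sides of \<open>ma\<close> and
    \<open>mb\<close>; their bounds add up to (2 \<gamma> - 1) + 3 = 2 (1 + \<gamma>).\<close>
  have "q * (2 * (1 + \<gamma>)) = 2 * m * (1 + \<gamma>) * a + 3 * (2 * m * M\<^sup>2 * (1 + \<gamma>) ^ 3 * b)"
    by (simp add: q_def R_def power2_eq_square power3_eq_cube algebra_simps)
  also have "\<dots> < 1 * (2 * (1 + \<gamma>))"
    using ma mb by simp
  finally have "q < 1"
    using \<gamma> by (simp add: mult_less_cancel_right)
  \<comment> \<open>The same two quantities appear here with weight one each, so the factor of
    \<open>M\<close> is below (2 \<gamma> - 1) + 1 = 2 \<gamma>.\<close>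
  have "m * (a * R + b * R ^ 3) * 2 =
      (2 * m * (1 + \<gamma>) * a + 2 * m * M\<^sup>2 * (1 + \<gamma>) ^ 3 * b) * M"
    by (simp add: R_def power2_eq_square power3_eq_cube algebra_simps)
  also have "\<dots> \<le> (2 * \<gamma>) * M"
    using ma mb \<open>M > 0\<close> by (intro mult_right_mono) auto
  finally have self_map: "m * (a * R + b * R ^ 3) \<le> \<gamma> * M"
    by simp

  \<comment> \<open>Bounds for the kernel and the nonlinear term\<close>
  have AE_a: "AE y in ?N. \<bar>\<alpha> y\<bar> \<le> a" and AE_b: "AE y in ?N. \<bar>\<beta> y\<bar> \<le> b"
    using a b by (auto intro: AE_abs_le_Linf_norm)
  have G_bound: "ennreal (k\<^sup>2) * (\<integral>\<^sup>+ y. ennreal \<bar>G x y\<bar> \<partial>?N) \<le> ennreal m" if "x \<in> \<Omega>" for x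
    using that unfolding m(1)[symmetric] mu_eq green_const_def
    by (intro mult_left_mono SUP_upper) auto
  \<comment> \<open>Kernel \<open>G x\<close> with x in \<Omega> and weight k squared; the function
    and its essential bound stay open. They will be \<open>F u\<close> for the self-map and
    \<open>F u - F v\<close> for the contraction.\<close>
  note kernel_bound = kernel_integral_bound[OF meas_G _ _ _ \<open>0 \<le> m\<close> _ G_bound]
  define F where "F u y = \<alpha> y * u y + \<beta> y * u y ^ 3" for u y
  have T_F: "T u x = u\<^sub>0 x - k\<^sup>2 * (\<integral>y. G x y * F u y \<partial>?N)" if "x \<in> \<Omega>" for u x
    using that closure_subset[of \<Omega>] \<Omega>_sets
    by (auto simp: T_eq T_op_def F_def set_lebesgue_integral_def integral_restrict_space)
  have F_meas: "F u \<in> borel_measurable ?N" if "u \<in> mspace ?X" for u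
    unfolding F_def using meas_u[OF that] by measurable
  have F_bound: "AE y in ?N. \<bar>F u y\<bar> \<le> a * R + b * R ^ 3"
    if u: "\<And>y. y \<in> \<Omega> \<Longrightarrow> \<bar>u y\<bar> \<le> R" for u
    using AE_a AE_b AE_space[of ?N]
  proof eventually_elim
    case (elim y)
    have "\<bar>u y\<bar> \<le> R"
      using u elim by simp
    then have "\<bar>\<alpha> y\<bar> * \<bar>u y\<bar> \<le> a * R" "\<bar>\<beta> y\<bar> * \<bar>u y\<bar> ^ 3 \<le> b * R ^ 3"
      using elim a b \<open>R > 0\<close> by (auto intro!: mult_mono power_mono)
    then show ?case
      unfolding F_def by (intro order_trans[OF abs_triangle_ineq]) (simp add: abs_mult power_abs)
  qed
  have F_diff_bound: "AE y in ?N. \<bar>F u y - F v y\<bar> \<le> (a + 3 * b * R\<^sup>2) * \<delta>"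
    if u: "\<And>y. y \<in> \<Omega> \<Longrightarrow> \<bar>u y\<bar> \<le> R" and v: "\<And>y. y \<in> \<Omega> \<Longrightarrow> \<bar>v y\<bar> \<le> R"
      and uv: "\<And>y. y \<in> \<Omega> \<Longrightarrow> \<bar>u y - v y\<bar> \<le> \<delta>" for u v \<delta>
    using AE_a AE_b AE_space[of ?N]
  proof eventually_elim
    case (elim y)
    then have y: "y \<in> \<Omega>"
      by simp
    have "\<bar>u y ^ 3 - v y ^ 3\<bar> \<le> 3 * R\<^sup>2 * \<bar>u y - v y\<bar>"
      using u v y by (intro abs_cube_diff_le)
    also have "\<dots> \<le> 3 * R\<^sup>2 * \<delta>"
      using uv[OF y] by (intro mult_left_mono) auto
    finally have "\<bar>\<beta> y\<bar> * \<bar>u y ^ 3 - v y ^ 3\<bar> \<le> b * (3 * R\<^sup>2 * \<delta>)"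
      using elim b by (intro mult_mono) auto
    moreover have "\<bar>\<alpha> y\<bar> * \<bar>u y - v y\<bar> \<le> a * \<delta>"
      using elim a uv[OF y] by (intro mult_mono) auto
    moreover have "F u y - F v y = \<alpha> y * (u y - v y) + \<beta> y * (u y ^ 3 - v y ^ 3)"
      by (simp add: F_def algebra_simps)
    then have "\<bar>F u y - F v y\<bar> \<le> \<bar>\<alpha> y\<bar> * \<bar>u y - v y\<bar> + \<bar>\<beta> y\<bar> * \<bar>u y ^ 3 - v y ^ 3\<bar>"
      by (metis abs_mult abs_triangle_ineq)
    ultimately show ?case
      by (simp add: algebra_simps)
  qed
  have ball_bound: "\<bar>u y\<bar> \<le> R" if "u \<in> mspace ?X" "mdist ?X u\<^sub>0 u \<le> \<gamma> * M" "y \<in> \<Omega>" for u y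
  proof -
    have y: "y \<in> closure \<Omega>"
      using that closure_subset by blast
    have "\<bar>u\<^sub>0 y - u y\<bar> \<le> \<gamma> * M"
      using abs_diff_le_mdist_C_closure[OF u0 that(1) y] that(2) by simp
    moreover have "\<bar>u\<^sub>0 y\<bar> \<le> M"
      unfolding M_def using u0 y by (rule abs_le_sup_norm)
    ultimately show ?thesis
      by (simp add: R_def algebra_simps)
  qed

  \<comment> \<open>Self-map and contraction on the ball\<close>
  have "\<exists>!u. u \<in> mspace ?X \<and> mdist ?X u\<^sub>0 u \<le> \<gamma> * M \<and> T u = u"
  proof (rule closed_ball_unique_fixed_point[OF mcomplete_C_closure u0 _ \<open>q < 1\<close>])
    show "0 \<le> \<gamma> * M"
      using \<gamma> \<open>M > 0\<close> by simp
    fix u assume u: "u \<in> mspace ?X" "mdist ?X u\<^sub>0 u \<le> \<gamma> * M"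
    have Tu: "T u \<in> mspace ?X"
      using T_maps u by blast
    have "\<bar>u\<^sub>0 x - T u x\<bar> \<le> \<gamma> * M" if "x \<in> \<Omega>" for x
      using kernel_bound(2)[OF that F_meas[OF u(1)] F_bound[OF ball_bound[OF u]]]
        that k a b \<open>R > 0\<close> self_map
      by (simp add: T_F)
    then have "mdist ?X u\<^sub>0 (T u) \<le> \<gamma> * M"
      using Tu u0 \<gamma> \<open>M > 0\<close> by (intro mdist_C_closure_le) auto
    with Tu show "T u \<in> mspace ?X \<and> mdist ?X u\<^sub>0 (T u) \<le> \<gamma> * M"
      by blast
    fix v assume v: "v \<in> mspace ?X" "mdist ?X u\<^sub>0 v \<le> \<gamma> * M"
    have Tv: "T v \<in> mspace ?X"
      using T_maps v by blast
    define \<delta> where "\<delta> = mdist ?X u v"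
    have "\<delta> \<ge> 0"
      by (simp add: \<delta>_def)
    have uv: "\<bar>u y - v y\<bar> \<le> \<delta>" if "y \<in> \<Omega>" for y
      using that closure_subset u v unfolding \<delta>_def by (intro abs_diff_le_mdist_C_closure) auto
    have "\<bar>T u x - T v x\<bar> \<le> q * \<delta>" if x: "x \<in> \<Omega>" for x
    proof -
      \<comment> \<open>Integrability of both integrands is what allows the two integrals to be
        merged into one.\<close>
      have int: "integrable ?N (\<lambda>y. G x y * F w y)"
        if "w \<in> mspace ?X" "mdist ?X u\<^sub>0 w \<le> \<gamma> * M" for w
        using kernel_bound(1)[OF x F_meas[OF that(1)] F_bound[OF ball_bound[OF that]]]
          x k a b \<open>R > 0\<close> by simp
      \<comment> \<open>The integral enters \<open>T\<close> with a minus sign, so the difference is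
        taken in reverse order; \<open>abs_minus_commute\<close> restores it.\<close>
      have "T v x - T u x = k\<^sup>2 * (\<integral>y. G x y * (F u y - F v y) \<partial>?N)"
        using int[OF u] int[OF v] x by (simp add: T_F algebra_simps)
      also have "\<bar>\<dots>\<bar> \<le> m * ((a + 3 * b * R\<^sup>2) * \<delta>)"
        using F_diff_bound[OF ball_bound[OF u] ball_bound[OF v] uv] F_meas[OF u(1)] F_meas[OF v(1)]
          x k a b \<open>\<delta> \<ge> 0\<close>
        by (intro kernel_bound) auto
      finally show ?thesis
        by (simp add: q_def abs_minus_commute mult.assoc)
    qed
    \<comment> \<open>\<open>mdist_C_closure_le\<close> asks for a nonnegative bound, which
      \<open>q < 1\<close> alone does not give.\<close>
    moreover have "0 \<le> q * \<delta>"
      using m a b \<open>\<delta> \<ge> 0\<close> by (simp add: q_def)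
    ultimately show "mdist ?X (T u) (T v) \<le> q * mdist ?X u v"
      using Tu Tv unfolding \<delta>_def by (intro mdist_C_closure_le) auto
  qed
  then show ?thesis
    by (simp only: M_def)
qed

end
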